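(* Let $G$ be a topological semigroup with identity acting continuously on a compact Hausdorff space $X$ by surjective continuous maps. Let $k\ge2$ and $(x_1,\dots,x_k)\in X^k\setminus\Delta_k(X)$. Then $(x_1,\dots,x_k)$ is a sequence entropy tuple if and only if it is an IN-tuple.
   Context: $\Delta_k(X)=\{(x,\dots,x)\}$. For $s\in G$ and $A\subseteq X$, $s^{-1}A=\{x\in X: sx\in A\}$. For a sequence $\mathfrak s=\{s_n\}_{n\in{\mathbb N}}$ in $G$ and a finite open cover ${\mathcal U}$ of $X$, ${\rm h}_{\rm top}(X,{\mathcal U};\mathfrak s)=\limsup_{n\to\infty}\frac1n\log N(\bigvee_{i=1}^n s_i^{-1}{\mathcal U})$, where $N(\cdot)$ is the minimal cardinality of a subcover. A tuple $(x_1,\dots,x_k)\in X^k\setminus\Delta_k(X)$ is a sequence entropy tuple if whenever $U_1,\dots,U_l$ are closed pairwise disjoint neighbourhoods of the distinct points in the list $x_1,\dots,x_k$, there is a sequence $\mathfrak s$ in $G$ with ${\rm h}_{\rm top}(X,\{U_1^{\rm c},\dots,U_l^{\rm c}\};\mathfrak s)>0$. For a tuple $(A_1,\dots,A_k)$ of subsets of $X$, $J\subseteq G$ is an independence set if for every nonempty finite $I\subseteq J$ and $\sigma:I\to\{1,\dots,k\}$, $\bigcap_{s\in I}s^{-1}A_{\sigma(s)}\neq\emptyset$. A tuple $(x_1,\dots,x_k)\in X^k$ is an IN-tuple if for every product neighbourhood $U_1\times\cdots\times U_k$ of it, $(U_1,\dots,U_k)$ has arbitrarily large finite independence sets. *)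

theory Defs
  imports "HOL-Analysis.Analysis" "HOL-Library.Extended_Real"
begin

definition top_monoid_action :: "('g::{topological_space,monoid_mult} \<Rightarrow> 'x::t2_space \<Rightarrow> 'x) \<Rightarrow> bool" where
  "top_monoid_action act \<longleftrightarrow>
     continuous_on UNIV (\<lambda>p::'g \<times> 'g. fst p * snd p) \<and>
     compact (UNIV :: 'x set) \<and>
     continuous_on UNIV (\<lambda>p::'g \<times> 'x. act (fst p) (snd p)) \<and>
     (\<forall>x. act 1 x = x) \<and>
     (\<forall>s t x. act (s * t) x = act s (act t x)) \<and>
     (\<forall>s. surj (act s))"

definition N_cover :: "'x set set \<Rightarrow> nat" where
  "N_cover C = (LEAST n. \<exists>F. F \<subseteq> C \<and> finite F \<and> card F = n \<and> \<Union>F = UNIV)"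

definition join_seq :: "('g \<Rightarrow> 'x \<Rightarrow> 'x) \<Rightarrow> (nat \<Rightarrow> 'g) \<Rightarrow> 'x set set \<Rightarrow> nat \<Rightarrow> 'x set set" where
  "join_seq act s U n =
     {(\<Inter>i\<in>{1..n}. act (s i) -` V i) | V. \<forall>i\<in>{1..n}. V i \<in> U}"

definition htop_seq :: "('g \<Rightarrow> 'x \<Rightarrow> 'x) \<Rightarrow> 'x set set \<Rightarrow> (nat \<Rightarrow> 'g) \<Rightarrow> ereal" where
  "htop_seq act U s =
     limsup (\<lambda>n. ereal (ln (real (N_cover (join_seq act s U n))) / real n))"

text \<open>Tuples are x 0, ..., x (k-1).\<close>
definition in_diagonal :: "nat \<Rightarrow> (nat \<Rightarrow> 'x) \<Rightarrow> bool" where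
  "in_diagonal k x \<longleftrightarrow> (\<forall>i<k. \<forall>j<k. x i = x j)"

definition seq_entropy_tuple :: "('g \<Rightarrow> 'x::topological_space \<Rightarrow> 'x) \<Rightarrow> nat \<Rightarrow> (nat \<Rightarrow> 'x) \<Rightarrow> bool" where
  "seq_entropy_tuple act k x \<longleftrightarrow>
     \<not> in_diagonal k x \<and>
     (\<forall>U :: 'x \<Rightarrow> 'x set.
        (\<forall>p\<in>x ` {..<k}. closed (U p) \<and> p \<in> interior (U p)) \<and>
        (\<forall>p\<in>x ` {..<k}. \<forall>q\<in>x ` {..<k}. p \<noteq> q \<longrightarrow> U p \<inter> U q = {})
        \<longrightarrow> (\<exists>s :: nat \<Rightarrow> 'g. htop_seq act ((\<lambda>p. - U p) ` (x ` {..<k})) s > 0))"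

definition independence_set :: "('g \<Rightarrow> 'x \<Rightarrow> 'x) \<Rightarrow> nat \<Rightarrow> (nat \<Rightarrow> 'x set) \<Rightarrow> 'g set \<Rightarrow> bool" where
  "independence_set act k A J \<longleftrightarrow>
     (\<forall>I. I \<subseteq> J \<and> finite I \<and> I \<noteq> {} \<longrightarrow>
        (\<forall>\<sigma>. (\<forall>s\<in>I. \<sigma> s < k) \<longrightarrow> (\<Inter>s\<in>I. act s -` A (\<sigma> s)) \<noteq> {}))"

definition IN_tuple :: "('g \<Rightarrow> 'x::topological_space \<Rightarrow> 'x) \<Rightarrow> nat \<Rightarrow> (nat \<Rightarrow> 'x) \<Rightarrow> bool" where
  "IN_tuple act k x \<longleftrightarrow>
     (\<forall>U :: nat \<Rightarrow> 'x set. (\<forall>i<k. x i \<in> interior (U i)) \<longrightarrow>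
        (\<forall>n. \<exists>J. finite J \<and> card J \<ge> n \<and> independence_set act k U J))"

end

theory Submission
  imports Defs "HOL-Real_Asymp.Real_Asymp"
begin

text \<open>
  If the preimages of the neighbourhoods along a sequence shatter no large index set, then the
  number of shattered subsets of the first n indices is polynomial in n, and a halving argument
  bounds the covering number of the n-th join by exp (O ((ln n)^2)); hence positive sequence
  entropy forces large independence sets. Conversely, independence sets of size 2^m are placed in
  the blocks of indices from 2^m + 1 to 2^(m+1). The last block then makes up half of each initial
  segment, and an independence set of size r gives covering number at least (l / (l - 1))^r for
  l distinct points, since a member of the join contains at most (l - 1)^r of the l^r witnesses.
\<close>

section \<open>Shattered index sets and their number\<close>

text \<open>Shattering as in Vapnik-Chervonenkis theory, with label set \<open>P\<close> in place of
  two values: \<open>A z p\<close> holds the points with label \<open>p\<close> at coordinate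
  \<open>z\<close>. The parameter \<open>S\<close> lets an induction pass to the points with a
  prescribed label.\<close>

definition shatters :: "('i \<Rightarrow> 'p \<Rightarrow> 'a set) \<Rightarrow> 'p set \<Rightarrow> 'a set \<Rightarrow> 'i set \<Rightarrow> bool" where
  "shatters A P S W \<longleftrightarrow>
     (\<forall>\<sigma>. (\<forall>z\<in>W. \<sigma> z \<in> P) \<longrightarrow> (\<exists>y\<in>S. \<forall>z\<in>W. y \<in> A z (\<sigma> z)))"

definition shattered :: "('i \<Rightarrow> 'p \<Rightarrow> 'a set) \<Rightarrow> 'p set \<Rightarrow> 'a set \<Rightarrow> 'i set \<Rightarrow> 'i set set" where
  "shattered A P S Z = {W. W \<subseteq> Z \<and> shatters A P S W}"

lemma finite_shattered: "finite Z \<Longrightarrow> finite (shattered A P S Z)"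
  by (rule finite_subset[of _ "Pow Z"]) (auto simp: shattered_def)

lemma shattersD:
  "shatters A P S W \<Longrightarrow> \<forall>z\<in>W. \<sigma> z \<in> P \<Longrightarrow> \<exists>y\<in>S. \<forall>z\<in>W. y \<in> A z (\<sigma> z)"
  unfolding shatters_def by simp

lemma shatters_mono: "shatters A P S W \<Longrightarrow> S \<subseteq> S' \<Longrightarrow> shatters A P S' W"
  unfolding shatters_def by blast

lemma shatters_insert:
  assumes "\<And>j. j \<in> P \<Longrightarrow> shatters A P (S \<inter> A z j) W"
  shows "shatters A P S (insert z W)"
  unfolding shatters_def
proof (intro allI impI)
  fix \<sigma> assume \<sigma>: "\<forall>w\<in>insert z W. \<sigma> w \<in> P"
  then have "shatters A P (S \<inter> A z (\<sigma> z)) W" using assms by blast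
  then have "\<exists>y\<in>S \<inter> A z (\<sigma> z). \<forall>w\<in>W. y \<in> A w (\<sigma> w)"
    using \<sigma> unfolding shatters_def by blast
  then show "\<exists>y\<in>S. \<forall>w\<in>insert z W. y \<in> A w (\<sigma> w)" by blast
qed

text \<open>If every part \<open>S \<inter> A z j\<close> shatters \<open>W\<close>, then
  \<open>S\<close> shatters both \<open>W\<close> and \<open>insert z W\<close>, and the latter is
  new because it contains \<open>z\<close>. This is the counting step behind Pajor's form of the
  Sauer-Shelah lemma.\<close>

lemma card_shattered_insert:
  assumes "finite Z" "z \<notin> Z" "P \<noteq> {}"
  shows "card (shattered A P S Z) + card (\<Inter>j\<in>P. shattered A P (S \<inter> A z j) Z)
           \<le> card (shattered A P S (insert z Z))"
proof -
  let ?I = "\<Inter>j\<in>P. shattered A P (S \<inter> A z j) Z"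
  \<comment> \<open>Over an empty \<open>P\<close> the intersection would be
    \<open>UNIV\<close>.\<close>
  have sub: "W \<subseteq> Z" if "W \<in> ?I" for W
    using that \<open>P \<noteq> {}\<close> by (auto simp: shattered_def)
  have finI: "finite ?I" by (rule finite_subset[of _ "Pow Z"]) (use sub assms in auto)
  have inj: "inj_on (insert z) ?I"
    using sub \<open>z \<notin> Z\<close> by (intro inj_onI) (metis insert_ident subsetD)
  have "shattered A P S Z \<union> insert z ` ?I \<subseteq> shattered A P S (insert z Z)"
  proof
    fix W assume "W \<in> shattered A P S Z \<union> insert z ` ?I"
    then show "W \<in> shattered A P S (insert z Z)"
    proof
      assume "W \<in> insert z ` ?I"
      then obtain T where T: "T \<in> ?I" "W = insert z T" by blast
      have "shatters A P S (insert z T)"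
        by (rule shatters_insert) (use T in \<open>auto simp: shattered_def\<close>)
      then show ?thesis using T sub[of T] by (auto simp: shattered_def)
    qed (auto simp: shattered_def)
  qed
  moreover have "shattered A P S Z \<inter> insert z ` ?I = {}"
    using \<open>z \<notin> Z\<close> by (auto simp: shattered_def)
  ultimately have "card (shattered A P S Z) + card (insert z ` ?I)
      \<le> card (shattered A P S (insert z Z))"
    by (metis assms(1) card_Un_disjoint card_mono finI finite_imageI finite_insert finite_shattered)
  then show ?thesis by (simp add: card_image[OF inj])
qed

section \<open>Light labels and the halving argument\<close>

text \<open>Union bound: a member of \<open>C\<close> missing from the intersection is missing from
  some \<open>D j\<close>.\<close>

lemma card_le_card_INTER_plus_sum:
  assumes "finite P" "finite C" "\<And>j. j \<in> P \<Longrightarrow> D j \<subseteq> C"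
  shows "card C \<le> card (C \<inter> (\<Inter>j\<in>P. D j)) + (\<Sum>j\<in>P. card C - card (D j))"
proof -
  have "C = (C \<inter> (\<Inter>j\<in>P. D j)) \<union> (\<Union>j\<in>P. C - D j)" by blast
  then have "card C \<le> card (C \<inter> (\<Inter>j\<in>P. D j)) + card (\<Union>j\<in>P. C - D j)"
    by (metis card_Un_le)
  also have "card (\<Union>j\<in>P. C - D j) \<le> (\<Sum>j\<in>P. card (C - D j))"
    using assms(1) by (rule card_UN_le)
  also have "\<dots> = (\<Sum>j\<in>P. card C - card (D j))"
    using assms by (intro sum.cong refl card_Diff_subset) (blast intro: finite_subset)+
  finally show ?thesis by simp
qed

text \<open>Let l be \<open>card P\<close>, and let N and N' count the sets shattered in
  \<open>Z\<close> and in \<open>insert z Z\<close>. If every label kept more than the fraction 1 -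
  1/(2l) of N', each would lose at most N'/(2l) of the N sets, so at least N - N'/2 sets would
  survive all labels. Counting these twice gives 2N - N'/2 \<le> N', against N > 3N'/4.\<close>

lemma exists_light_label:
  assumes "finite Z" "z \<notin> Z" "finite P" "card P \<ge> 2"
  obtains j where "j \<in> P"
    "real (card (shattered A P (S \<inter> A z j) Z))
       \<le> (1 - 1 / (2 * real (card P))) * real (card (shattered A P S (insert z Z)))"
proof -
  let ?l = "real (card P)"
  let ?N' = "real (card (shattered A P S (insert z Z)))"
  let ?N = "real (card (shattered A P S Z))"
  let ?c = "\<lambda>j. real (card (shattered A P (S \<inter> A z j) Z))"
  let ?I = "\<Inter>j\<in>P. shattered A P (S \<inter> A z j) Z"
  have ne: "P \<noteq> {}" using assms by auto
  have l: "?l \<ge> 2" using assms by simp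
  have "\<exists>j\<in>P. ?c j \<le> (1 - 1 / (2 * ?l)) * ?N'"
  proof (rule ccontr)
    assume "\<not> ?thesis"
    then have big: "?c j > (1 - 1 / (2 * ?l)) * ?N'" if "j \<in> P" for j
      using that by force
    have sub: "shattered A P (S \<inter> A z j) Z \<subseteq> shattered A P S Z" for j
      unfolding shattered_def using shatters_mono[of A P "S \<inter> A z j" _ S] by blast
    have sub': "?c j \<le> ?N" for j
      using card_mono[OF finite_shattered[OF assms(1)] sub] by simp
    have IN: "shattered A P S Z \<inter> ?I = ?I" using sub ne by blast
    have "card (shattered A P S Z) + card ?I \<le> card (shattered A P S (insert z Z))"
      by (rule card_shattered_insert) (use assms ne in auto)
    then have 1: "?N + real (card ?I) \<le> ?N'" by linarith
    have "card (shattered A P S Z) \<le> card (shattered A P S Z \<inter> ?I)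
        + (\<Sum>j\<in>P. card (shattered A P S Z) - card (shattered A P (S \<inter> A z j) Z))"
      by (rule card_le_card_INTER_plus_sum) (use assms finite_shattered sub in auto)
    then have "?N \<le> real (card ?I)
        + (\<Sum>j\<in>P. real (card (shattered A P S Z) - card (shattered A P (S \<inter> A z j) Z)))"
      unfolding IN of_nat_sum[symmetric] of_nat_add[symmetric] of_nat_le_iff .
    also have "(\<Sum>j\<in>P. real (card (shattered A P S Z) - card (shattered A P (S \<inter> A z j) Z)))
        \<le> (\<Sum>j\<in>P. ?N' / (2 * ?l))"
    proof (rule sum_mono)
      fix j assume "j \<in> P"
      have "real (card (shattered A P S Z) - card (shattered A P (S \<inter> A z j) Z)) = ?N - ?c j"
        using sub'[of j] by (simp add: of_nat_diff)
      also have "\<dots> \<le> ?N' - (1 - 1 / (2 * ?l)) * ?N'" using big[OF \<open>j \<in> P\<close>] 1 by linarith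
      also have "\<dots> = ?N' / (2 * ?l)" by (simp add: algebra_simps)
      finally show "real (card (shattered A P S Z) - card (shattered A P (S \<inter> A z j) Z)) \<le> ?N' / (2 * ?l)" .
    qed
    also have "\<dots> = ?N' / 2" using l by simp
    finally have 2: "?N \<le> real (card ?I) + ?N' / 2" by simp
    obtain j where "j \<in> P" using ne by blast
    \<comment> \<open>Having at least two labels gives the fraction 3/4, exactly what the
      contradiction requires.\<close>
    have "1 / (2 * ?l) \<le> 1 / 4" using l by (simp add: field_simps)
    then have "(1 - 1 / (2 * ?l)) * ?N' \<ge> (3 / 4) * ?N'" by (intro mult_right_mono) auto
    then have "?N > 3 / 4 * ?N'" using big[OF \<open>j \<in> P\<close>] sub'[of j] by linarith
    then show False using 1 2 by linarith
  qed
  then show ?thesis using that by blast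
qed

text \<open>
  A halving argument: process the coordinates one by one, guessing at each coordinate that the
  light label is avoided. A wrong guess shrinks the number of shattered sets by a constant factor,
  so at most d wrong guesses occur, and a choice function is determined by their positions.
\<close>
lemma avoiding_family:
  fixes A :: "'i \<Rightarrow> 'p \<Rightarrow> 'a set"
  assumes "finite Z" "finite P" "card P \<ge> 2"
    and "\<And>z p q. p \<in> P \<Longrightarrow> q \<in> P \<Longrightarrow> p \<noteq> q \<Longrightarrow> A z p \<inter> A z q = {}"
    and "real (card (shattered A P S Z)) * (1 - 1 / (2 * real (card P))) ^ d < 1"
  shows "\<exists>\<V>. finite \<V> \<and> card \<V> \<le> (card Z + 1) ^ d \<and> (\<forall>V\<in>\<V>. \<forall>z\<in>Z. V z \<in> P) \<and>
           (\<forall>x\<in>S. \<exists>V\<in>\<V>. \<forall>z\<in>Z. x \<notin> A z (V z))"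
  using assms(1,5)
proof (induction Z arbitrary: S d rule: finite_induct)
  case empty
  show ?case by (rule exI[of _ "{\<lambda>_. undefined}"]) auto
next
  case (insert z Z)
  let ?q = "1 - 1 / (2 * real (card P))"
  have q: "?q > 0" using assms(3) by (simp add: field_simps)
  show ?case
  proof (cases d)
    case 0
    \<comment> \<open>The budget of wrong guesses is exhausted: not even the empty set is shattered,
      so \<open>S\<close> has no points and the empty family suffices.\<close>
    then have "card (shattered A P S (insert z Z)) = 0" using insert.prems by simp
    then have "shattered A P S (insert z Z) = {}"
      using insert.hyps finite_shattered by (metis card_eq_0_iff finite_insert)
    then have "{} \<notin> shattered A P S (insert z Z)" by blast
    then have "S = {}" by (auto simp: shattered_def shatters_def)
    then show ?thesis by (intro exI[of _ "{}"]) auto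
  next
    case (Suc d')
    obtain j where j: "j \<in> P"
      "real (card (shattered A P (S \<inter> A z j) Z)) \<le> ?q * real (card (shattered A P S (insert z Z)))"
      using exists_light_label[OF insert.hyps assms(2,3)] by blast
    \<comment> \<open>\<open>j'\<close> is the label to avoid for points of \<open>A z j\<close>:
      disjointness keeps them out of \<open>A z j'\<close>.\<close>
    obtain j' where j': "j' \<in> P" "j' \<noteq> j"
    proof -
      have "\<not> P \<subseteq> {j}" using assms(2,3) card_mono[of "{j}" P] by auto
      then show ?thesis using that by blast
    qed
    \<comment> \<open>Wrong guess: the points of \<open>A z j\<close> are handled with one unit less
      of \<open>d\<close>, paid for by the drop in the number of shattered sets.\<close>
    have "real (card (shattered A P (S \<inter> A z j) Z)) * ?q ^ d'
        \<le> (?q * real (card (shattered A P S (insert z Z)))) * ?q ^ d'"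
      using j(2) q by (intro mult_right_mono) auto
    also have "\<dots> < 1" using insert.prems Suc by (simp add: mult_ac)
    finally have "real (card (shattered A P (S \<inter> A z j) Z)) * ?q ^ d' < 1" .
    from insert.IH[OF this] obtain \<V>1 where V1: "finite \<V>1" "card \<V>1 \<le> (card Z + 1) ^ d'"
      "\<forall>V\<in>\<V>1. \<forall>z\<in>Z. V z \<in> P" "\<forall>x\<in>S \<inter> A z j. \<exists>V\<in>\<V>1. \<forall>z\<in>Z. x \<notin> A z (V z)"
      by blast
    \<comment> \<open>Right guess: \<open>S\<close> and \<open>d\<close> stay and only the
      coordinate \<open>z\<close> is removed, which cannot raise the number of shattered
      sets.\<close>
    have "card (shattered A P S Z) \<le> card (shattered A P S (insert z Z))"
      using insert.hyps by (intro card_mono finite_shattered) (auto simp: shattered_def)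
    then have "real (card (shattered A P S Z)) * ?q ^ d
        \<le> real (card (shattered A P S (insert z Z))) * ?q ^ d"
      using q by (intro mult_right_mono) auto
    then have "real (card (shattered A P S Z)) * ?q ^ d < 1"
      using insert.prems by linarith
    from insert.IH[OF this] obtain \<V>2 where V2: "finite \<V>2" "card \<V>2 \<le> (card Z + 1) ^ d"
      "\<forall>V\<in>\<V>2. \<forall>z\<in>Z. V z \<in> P" "\<forall>x\<in>S. \<exists>V\<in>\<V>2. \<forall>z\<in>Z. x \<notin> A z (V z)"
      by blast
    let ?\<V> = "(\<lambda>V. V(z := j')) ` \<V>1 \<union> (\<lambda>V. V(z := j)) ` \<V>2"
    have "card ?\<V> \<le> card \<V>1 + card \<V>2"
      using V1(1) V2(1) by (meson add_mono card_Un_le card_image_le le_trans)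
    also have "\<dots> \<le> (card Z + 1) ^ d' + (card Z + 1) ^ d" using V1 V2 by simp
    also have "\<dots> = (card Z + 2) * (card Z + 1) ^ d'" by (simp add: Suc algebra_simps)
    also have "\<dots> \<le> (card Z + 2) * (card Z + 2) ^ d'" by (intro mult_left_mono power_mono) auto
    also have "\<dots> = (card (insert z Z) + 1) ^ d" using insert.hyps Suc by simp
    finally have "card ?\<V> \<le> (card (insert z Z) + 1) ^ d" .
    moreover have "\<exists>V\<in>?\<V>. \<forall>w\<in>insert z Z. x \<notin> A w (V w)" if x: "x \<in> S" for x
    proof (cases "x \<in> A z j")
      case True
      then obtain V where V: "V \<in> \<V>1" "\<forall>w\<in>Z. x \<notin> A w (V w)" using V1 x by blast
      have "x \<notin> A z j'" using True assms(4)[OF j(1) j'(1)] j'(2) by blast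
      then have "\<forall>w\<in>insert z Z. x \<notin> A w ((V(z := j')) w)" using V by auto
      then show ?thesis using V(1) by blast
    next
      case False
      obtain V where V: "V \<in> \<V>2" "\<forall>w\<in>Z. x \<notin> A w (V w)" using V2 x by blast
      have "\<forall>w\<in>insert z Z. x \<notin> A w ((V(z := j)) w)" using V False by auto
      then show ?thesis using V(1) by blast
    qed
    moreover have "\<forall>V\<in>?\<V>. \<forall>w\<in>insert z Z. V w \<in> P" using V1(3) V2(3) j(1) j'(1) by auto
    ultimately show ?thesis using V1(1) V2(1) by (intro exI[of _ ?\<V>]) blast
  qed
qed

section \<open>Covering numbers under bounded shattering\<close>

text \<open>A set of at most \<open>m\<close> elements is coded by a list of length exactly
  \<open>m\<close> over \<open>Z\<close> and the padding symbol \<open>None\<close>, with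
  \<open>card Z + 1\<close> choices per entry.\<close>

lemma card_small_subsets_le:
  assumes "finite Z"
  shows "card {W. W \<subseteq> Z \<and> card W \<le> m} \<le> (card Z + 1) ^ m"
proof -
  let ?L = "{xs. set xs \<subseteq> insert None (Some ` Z) \<and> length xs = m}"
  have "{W. W \<subseteq> Z \<and> card W \<le> m} \<subseteq> (\<lambda>xs. {w. Some w \<in> set xs}) ` ?L"
  proof
    fix W assume W: "W \<in> {W. W \<subseteq> Z \<and> card W \<le> m}"
    then obtain ws where ws: "set ws = W" "distinct ws"
      using assms finite_distinct_list finite_subset by (metis mem_Collect_eq)
    have len: "length ws \<le> m" using W ws distinct_card by fastforce
    let ?xs = "map Some ws @ replicate (m - length ws) None"
    have "?xs \<in> ?L" using W ws len by (auto split: if_splits)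
    moreover have "W = {w. Some w \<in> set ?xs}" using ws by auto
    ultimately show "W \<in> (\<lambda>xs. {w. Some w \<in> set xs}) ` ?L" by blast
  qed
  moreover have fin: "finite ?L" using assms by (intro finite_lists_length_eq) auto
  ultimately have "card {W. W \<subseteq> Z \<and> card W \<le> m} \<le> card ?L"
    using card_mono card_image_le by (meson finite_imageI le_trans)
  also have "\<dots> = card (insert None (Some ` Z)) ^ m"
    using assms by (intro card_lists_length_eq) auto
  also have "card (insert None (Some ` Z)) = card Z + 1"
    using assms by (subst card_insert_disjoint) (auto simp: card_image)
  finally show ?thesis .
qed

lemma N_cover_le_card:
  assumes "F \<subseteq> C" "finite F" "\<Union>F = UNIV"
  shows "N_cover C \<le> card F"
  unfolding N_cover_def by (rule Least_le) (use assms in blast)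

lemma N_cover_attained:
  assumes "finite C" "\<Union>C = UNIV"
  obtains F where "F \<subseteq> C" "finite F" "card F = N_cover C" "\<Union>F = UNIV"
proof -
  have "\<exists>F. F \<subseteq> C \<and> finite F \<and> card F = N_cover C \<and> \<Union>F = UNIV"
    unfolding N_cover_def
    by (rule LeastI[of "\<lambda>n. \<exists>F. F \<subseteq> C \<and> finite F \<and> card F = n \<and> \<Union>F = UNIV" "card C"])
      (use assms in blast)
  then show ?thesis using that by blast
qed

text \<open>Each function of an avoiding family names a member of the join that contains all points
  avoiding it, so the family yields a subcover. At most \<open>(n + 1) ^ M\<close> sets are
  shattered, which is why this power enters the condition on \<open>d\<close>.\<close>

lemma N_cover_join_seq_le:
  fixes U :: "'p \<Rightarrow> 'x set"
  assumes P: "finite P" "card P \<ge> 2"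
    and disj: "\<And>p q. p \<in> P \<Longrightarrow> q \<in> P \<Longrightarrow> p \<noteq> q \<Longrightarrow> U p \<inter> U q = {}"
    and small: "\<And>W. W \<subseteq> {1..n} \<Longrightarrow> shatters (\<lambda>i p. act (s i) -` U p) P UNIV W \<Longrightarrow> card W \<le> M"
    and d: "(real n + 1) ^ M * (1 - 1 / (2 * real (card P))) ^ d < 1"
  shows "N_cover (join_seq act s ((\<lambda>p. - U p) ` P) n) \<le> (n + 1) ^ d"
proof -
  let ?A = "\<lambda>i p. act (s i) -` U p"
  let ?q = "1 - 1 / (2 * real (card P))"
  have q: "?q > 0" using P(2) by (simp add: field_simps)
  have "card (shattered ?A P UNIV {1..n}) \<le> card {W. W \<subseteq> {1..n} \<and> card W \<le> M}"
    by (rule card_mono) (use small in \<open>auto simp: shattered_def\<close>)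
  also have "\<dots> \<le> (n + 1) ^ M" using card_small_subsets_le[of "{1..n}" M] by simp
  finally have "real (card (shattered ?A P UNIV {1..n})) \<le> real ((n + 1) ^ M)"
    by (simp only: of_nat_le_iff)
  then have "real (card (shattered ?A P UNIV {1..n})) * ?q ^ d \<le> (real n + 1) ^ M * ?q ^ d"
    using q by (intro mult_right_mono) (auto simp: add_ac)
  then have "real (card (shattered ?A P UNIV {1..n})) * ?q ^ d < 1" using d by linarith
  moreover have "?A i p \<inter> ?A i q = {}" if "p \<in> P" "q \<in> P" "p \<noteq> q" for i p q
    using disj[OF that] by blast
  ultimately have "\<exists>\<V>. finite \<V> \<and> card \<V> \<le> (card {1..n} + 1) ^ d \<and>
      (\<forall>V\<in>\<V>. \<forall>z\<in>{1..n}. V z \<in> P) \<and> (\<forall>x\<in>UNIV. \<exists>V\<in>\<V>. \<forall>z\<in>{1..n}. x \<notin> ?A z (V z))"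
    using P by (intro avoiding_family) auto
  then obtain \<V> where V: "finite \<V>" "card \<V> \<le> (card {1..n} + 1) ^ d"
    "\<forall>V\<in>\<V>. \<forall>z\<in>{1..n}. V z \<in> P" "\<forall>x\<in>UNIV. \<exists>V\<in>\<V>. \<forall>z\<in>{1..n}. x \<notin> ?A z (V z)"
    by (elim exE conjE)
  let ?F = "(\<lambda>V. \<Inter>i\<in>{1..n}. act (s i) -` (- U (V i))) ` \<V>"
  have "N_cover (join_seq act s ((\<lambda>p. - U p) ` P) n) \<le> card ?F"
  proof (rule N_cover_le_card)
    show "?F \<subseteq> join_seq act s ((\<lambda>p. - U p) ` P) n"
    proof
      fix B assume "B \<in> ?F"
      then obtain V where "V \<in> \<V>" "B = (\<Inter>i\<in>{1..n}. act (s i) -` (- U (V i)))" by blast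
      then show "B \<in> join_seq act s ((\<lambda>p. - U p) ` P) n"
        unfolding join_seq_def using V(3) by (intro CollectI exI[of _ "\<lambda>i. - U (V i)"]) auto
    qed
    show "\<Union>?F = UNIV" using V(4) by auto
  qed (use V in simp)
  also have "\<dots> \<le> card \<V>" using V(1) by (rule card_image_le)
  finally show ?thesis using V(2) by simp
qed

text \<open>With \<open>M\<close> fixed, a budget \<open>d\<close> of order ln n suffices, so the
  logarithm of the covering number is O((ln n)^2), negligible against n.\<close>

lemma htop_seq_le_zero:
  fixes U :: "'p \<Rightarrow> 'x set"
  assumes P: "finite P" "card P \<ge> 2"
    and disj: "\<And>p q. p \<in> P \<Longrightarrow> q \<in> P \<Longrightarrow> p \<noteq> q \<Longrightarrow> U p \<inter> U q = {}"
    and small: "\<And>W. finite W \<Longrightarrow> shatters (\<lambda>i p. act (s i) -` U p) P UNIV W \<Longrightarrow> card W \<le> M"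
  shows "htop_seq act ((\<lambda>p. - U p) ` P) s \<le> 0"
proof -
  let ?q = "1 - 1 / (2 * real (card P))"
  define c where "c = - ln ?q"
  have q: "?q > 0" "?q < 1" using P(2) by (auto simp: field_simps)
  have c: "c > 0" using q by (simp add: c_def)
  define m where "m = real M"
  let ?g = "\<lambda>n. (m * ln (real n + 1) / c + 2) * ln (real n + 1) / real n"
  have le: "ln (real (N_cover (join_seq act s ((\<lambda>p. - U p) ` P) n))) / real n \<le> ?g n" for n
  proof -
    let ?N = "N_cover (join_seq act s ((\<lambda>p. - U p) ` P) n)"
    \<comment> \<open>The condition \<open>(real n + 1) ^ M * ?q ^ d < 1\<close> amounts to d > m
      ln(n + 1) / c; the \<open>+ 1\<close> after rounding up makes the inequality strict.\<close>
    define d where "d = nat \<lceil>m * ln (real n + 1) / c\<rceil> + 1"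
    have pos: "m * ln (real n + 1) / c \<ge> 0" using c by (simp add: m_def)
    have d1: "real d > m * ln (real n + 1) / c" unfolding d_def by linarith
    have d2: "real d \<le> m * ln (real n + 1) / c + 2" unfolding d_def using pos by linarith
    have "m * ln (real n + 1) < real d * c" using d1 c by (simp add: field_simps)
    then have "ln ((real n + 1) ^ M * ?q ^ d) < 0"
      using q by (simp add: ln_mult ln_realpow c_def m_def)
    moreover have "(real n + 1) ^ M * ?q ^ d > 0" using q by simp
    ultimately have "(real n + 1) ^ M * ?q ^ d < 1" by (simp add: ln_less_zero_iff)
    moreover have "card W \<le> M" if "W \<subseteq> {1..n}" "shatters (\<lambda>i p. act (s i) -` U p) P UNIV W" for W
      using small[OF finite_subset[OF that(1)] that(2)] by simp
    ultimately have "?N \<le> (n + 1) ^ d"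
      by (intro N_cover_join_seq_le[OF P disj, where M = M])
    then have N: "real ?N \<le> (real n + 1) ^ d"
      by (metis of_nat_1 of_nat_add of_nat_le_iff of_nat_power)
    \<comment> \<open>By the convention \<open>ln 0 = 0\<close>, a covering number 0 meets the bound
      as well.\<close>
    have "ln (real ?N) \<le> real d * ln (real n + 1)"
    proof (cases "?N = 0")
      case False
      then have "ln (real ?N) \<le> ln ((real n + 1) ^ d)" using N by simp
      then show ?thesis by (simp add: ln_realpow)
    qed simp
    also have "\<dots> \<le> (m * ln (real n + 1) / c + 2) * ln (real n + 1)"
      using d2 by (intro mult_right_mono) auto
    finally show ?thesis by (intro divide_right_mono) auto
  qed
  have "?g \<longlonglongrightarrow> 0" using c by real_asymp
  then have "(\<lambda>n. ereal (?g n)) \<longlonglongrightarrow> 0" by (simp add: zero_ereal_def)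
  then have "limsup (\<lambda>n. ereal (?g n)) = 0" by (simp add: lim_imp_Limsup)
  moreover have "htop_seq act ((\<lambda>p. - U p) ` P) s \<le> limsup (\<lambda>n. ereal (?g n))"
    unfolding htop_seq_def by (intro Limsup_mono always_eventually allI) (simp only: ereal_less_eq le)
  ultimately show ?thesis by simp
qed

section \<open>From shattered index sets to independence sets\<close>

text \<open>Labels on the image of \<open>W\<close> pull back along \<open>s\<close> to labels of
  indices. Asking \<open>V (x i) \<subseteq> U i\<close> for every \<open>i\<close> covers tuples
  with repeated points, whose entries may carry different sets \<open>U i\<close>.\<close>

lemma independence_set_image:
  assumes sh: "shatters (\<lambda>i p. act (s i) -` V p) (x ` {..<k}) UNIV W"
    and sub: "\<And>i. i < k \<Longrightarrow> V (x i) \<subseteq> U i"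
    and k: "k > 0"
  shows "independence_set act k U (s ` W)"
  unfolding independence_set_def
proof (intro allI impI, elim conjE)
  fix I \<sigma> assume I: "I \<subseteq> s ` W" "\<forall>g\<in>I. \<sigma> g < k"
  \<comment> \<open>Indices whose element lies outside \<open>I\<close> get the default label 0, a
    valid label because \<open>k > 0\<close>.\<close>
  define \<tau> where "\<tau> i = (if s i \<in> I then \<sigma> (s i) else 0)" for i
  have \<tau>: "\<tau> i < k" for i using I k by (auto simp: \<tau>_def)
  have "\<forall>\<sigma>. (\<forall>i\<in>W. \<sigma> i \<in> x ` {..<k}) \<longrightarrow> (\<exists>y. \<forall>i\<in>W. act (s i) y \<in> V (\<sigma> i))"
    using sh unfolding shatters_def by auto
  from this[rule_format, of "\<lambda>i. x (\<tau> i)"] obtain y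
    where y: "\<forall>i\<in>W. act (s i) y \<in> V (x (\<tau> i))" using \<tau> by auto
  have "act g y \<in> U (\<sigma> g)" if "g \<in> I" for g
  proof -
    obtain i where i: "i \<in> W" "g = s i" using I \<open>g \<in> I\<close> by blast
    have "act (s i) y \<in> U (\<tau> i)" using y i(1) sub[OF \<tau>] by blast
    then show ?thesis using i \<open>g \<in> I\<close> by (simp add: \<tau>_def)
  qed
  then have "y \<in> (\<Inter>g\<in>I. act g -` U (\<sigma> g))" by auto
  then show "(\<Inter>g\<in>I. act g -` U (\<sigma> g)) \<noteq> {}" by blast
qed

text \<open>Two indices with the same element could be labelled \<open>p\<close> and
  \<open>q\<close>, which would send one point into both disjoint sets. Hence a large shattered
  index set yields equally many values of \<open>s\<close>.\<close>

lemma shatters_imp_inj_on: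
  assumes sh: "shatters (\<lambda>i p. act (s i) -` V p) P UNIV W"
    and "p \<in> P" "q \<in> P" "V p \<inter> V q = {}"
  shows "inj_on s W"
proof (rule inj_onI, rule ccontr)
  fix i j assume ij: "i \<in> W" "j \<in> W" "s i = s j" "i \<noteq> j"
  let ?\<sigma> = "\<lambda>l. if l = i then p else q"
  have "\<forall>l\<in>W. ?\<sigma> l \<in> P" using assms(2,3) by simp
  from shattersD[OF sh this] obtain y where y: "\<forall>l\<in>W. y \<in> act (s l) -` V (?\<sigma> l)"
    by (elim bexE)
  from bspec[OF y ij(1)] bspec[OF y ij(2)] ij show False using assms(4) by auto
qed

section \<open>Separation in compact Hausdorff spaces\<close>

text \<open>By induction: the new point \<open>a\<close> is separated from each old point, its
  finitely many neighbourhoods are intersected, and each old neighbourhood is shrunk.\<close>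

lemma disjoint_open_neighbourhoods:
  fixes P :: "'x::t2_space set"
  assumes "finite P"
  shows "\<exists>B. (\<forall>p\<in>P. open (B p) \<and> p \<in> B p) \<and> (\<forall>p\<in>P. \<forall>q\<in>P. p \<noteq> q \<longrightarrow> B p \<inter> B q = {})"
  using assms
proof (induction P rule: finite_induct)
  case (insert a P)
  from insert.IH obtain B where B: "\<forall>p\<in>P. open (B p) \<and> p \<in> B p"
    "\<forall>p\<in>P. \<forall>q\<in>P. p \<noteq> q \<longrightarrow> B p \<inter> B q = {}" by (elim exE conjE)
  have "\<forall>p\<in>P. \<exists>C D. open C \<and> open D \<and> a \<in> C \<and> p \<in> D \<and> C \<inter> D = {}"
    using insert.hyps(2) by (metis hausdorff)
  then obtain C D where CD: "\<forall>p\<in>P. open (C p) \<and> open (D p) \<and> a \<in> C p \<and> p \<in> D p \<and> C p \<inter> D p = {}"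
    by metis
  define E where "E p = (if p = a then (\<Inter>p\<in>P. C p) else B p \<inter> D p)" for p
  have "open (\<Inter>p\<in>P. C p)" using insert.hyps(1) CD by (intro open_INT) auto
  then have "\<forall>p\<in>insert a P. open (E p) \<and> p \<in> E p"
    using B CD by (auto simp: E_def)
  moreover have "\<forall>p\<in>insert a P. \<forall>q\<in>insert a P. p \<noteq> q \<longrightarrow> E p \<inter> E q = {}"
  proof (intro ballI impI)
    fix p q assume "p \<in> insert a P" "q \<in> insert a P" "p \<noteq> q"
    then consider "p = a" "q \<in> P" "q \<noteq> a" | "q = a" "p \<in> P" "p \<noteq> a" | "p \<in> P" "q \<in> P" "p \<noteq> a" "q \<noteq> a" by blast
    then show "E p \<inter> E q = {}"
      using B(2) CD \<open>p \<noteq> q\<close> by cases (fastforce simp: E_def)+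
  qed
  ultimately show ?case by blast
qed simp

text \<open>Regularity of compact Hausdorff spaces: finitely many open sets \<open>D q\<close>, each
  disjoint from a neighbourhood of \<open>p\<close>, cover the compact complement of
  \<open>B\<close>. The complement of their union is the required set.\<close>

lemma closed_neighbourhood_within_open:
  fixes p :: "'x::t2_space"
  assumes "compact (UNIV :: 'x set)" "open B" "p \<in> B"
  shows "\<exists>V. closed V \<and> p \<in> interior V \<and> V \<subseteq> B"
proof -
  have comp: "compact (- B)"
    using compact_Int_closed[OF assms(1), of "- B"] assms(2) by (simp add: closed_Compl)
  have "\<forall>q\<in>- B. \<exists>C D. open C \<and> open D \<and> p \<in> C \<and> q \<in> D \<and> C \<inter> D = {}"
    using assms(3) by (metis ComplD hausdorff)
  then obtain C D where CD: "\<forall>q\<in>- B. open (C q) \<and> open (D q) \<and> p \<in> C q \<and> q \<in> D q \<and> C q \<inter> D q = {}"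
    by metis
  from CD have "\<And>q. q \<in> - B \<Longrightarrow> open (D q)" "- B \<subseteq> (\<Union>q\<in>- B. D q)" by auto
  with comp obtain Q where Q: "Q \<subseteq> - B" "finite Q" "- B \<subseteq> (\<Union>q\<in>Q. D q)"
    by (rule compactE_image[of "- B" "- B" D])
  let ?V = "- (\<Union>q\<in>Q. D q)"
  have "open (\<Inter>q\<in>Q. C q)" using Q CD by (intro open_INT) auto
  moreover have "(\<Inter>q\<in>Q. C q) \<subseteq> ?V" using Q CD by fastforce
  moreover have "p \<in> (\<Inter>q\<in>Q. C q)" using Q CD by auto
  ultimately have "p \<in> interior ?V" by (meson interiorI)
  moreover have "closed ?V" using Q CD by (auto intro!: closed_Compl open_UN)
  ultimately show ?thesis using Q(3) by blast
qed

section \<open>Sequence entropy tuples are IN-tuples\<close>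

lemma card_image_ge_two:
  assumes "\<not> in_diagonal k x"
  shows "card (x ` {..<k}) \<ge> 2"
proof -
  obtain i j where "i < k" "j < k" "x i \<noteq> x j" using assms by (auto simp: in_diagonal_def)
  then have "card {x i, x j} \<le> card (x ` {..<k})" by (intro card_mono) auto
  then show ?thesis using \<open>x i \<noteq> x j\<close> by simp
qed

lemma seq_entropy_tuple_imp_IN_tuple:
  fixes act :: "'g \<Rightarrow> 'x::t2_space \<Rightarrow> 'x"
  assumes compact: "compact (UNIV :: 'x set)" and se: "seq_entropy_tuple act k x"
  shows "IN_tuple act k x"
  unfolding IN_tuple_def
proof (intro allI impI)
  fix U :: "nat \<Rightarrow> 'x set" and n :: nat
  assume U: "\<forall>i<k. x i \<in> interior (U i)"
  let ?P = "x ` {..<k}"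
  have nd: "\<not> in_diagonal k x" using se by (simp add: seq_entropy_tuple_def)
  note two = card_image_ge_two[OF nd]
  obtain B where B: "\<forall>p\<in>?P. open (B p) \<and> p \<in> B p"
    "\<forall>p\<in>?P. \<forall>q\<in>?P. p \<noteq> q \<longrightarrow> B p \<inter> B q = {}"
    using disjoint_open_neighbourhoods[of ?P] by auto
  \<comment> \<open>A repeated point \<open>p\<close> needs a single set that fits into
    \<open>U i\<close> for every \<open>i\<close> with \<open>x i = p\<close>; the factor
    \<open>B p\<close> provides disjointness.\<close>
  have "\<exists>V. closed V \<and> p \<in> interior V \<and> V \<subseteq> B p \<inter> (\<Inter>i\<in>{i. i < k \<and> x i = p}. interior (U i))"
    if "p \<in> ?P" for p
    by (rule closed_neighbourhood_within_open[OF compact])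
      (use that B U in \<open>auto intro!: open_Int open_INT\<close>)
  then obtain V where V: "\<And>p. p \<in> ?P \<Longrightarrow> closed (V p) \<and> p \<in> interior (V p) \<and>
      V p \<subseteq> B p \<inter> (\<Inter>i\<in>{i. i < k \<and> x i = p}. interior (U i))" by metis
  have disj: "V p \<inter> V q = {}" if "p \<in> ?P" "q \<in> ?P" "p \<noteq> q" for p q
  proof -
    have "V p \<subseteq> B p" "V q \<subseteq> B q" using V[OF that(1)] V[OF that(2)] by auto
    then show ?thesis using bspec[OF bspec[OF B(2) that(1)] that(2)] that(3) by auto
  qed
  have VU: "V (x i) \<subseteq> U i" if "i < k" for i
    using V[of "x i"] that interior_subset[of "U i"] by auto
  obtain s where s: "htop_seq act ((\<lambda>p. - V p) ` ?P) s > 0"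
    using se V disj unfolding seq_entropy_tuple_def by blast
  \<comment> \<open>If \<open>n\<close> bounded the size of all finite shattered sets, the entropy
    along \<open>s\<close> would be at most 0.\<close>
  have "\<exists>W. finite W \<and> shatters (\<lambda>i p. act (s i) -` V p) ?P UNIV W \<and> n < card W"
  proof (rule ccontr)
    assume "\<not> ?thesis"
    then have "htop_seq act ((\<lambda>p. - V p) ` ?P) s \<le> 0"
      by (intro htop_seq_le_zero[where M = n]) (use two disj in \<open>auto simp: not_less\<close>)
    then show False using s by simp
  qed
  then obtain W where W: "finite W" "shatters (\<lambda>i p. act (s i) -` V p) ?P UNIV W" "n < card W"
    by blast
  obtain i j where ij: "i < k" "j < k" "x i \<noteq> x j" using nd by (auto simp: in_diagonal_def)
  have "inj_on s W"
    by (rule shatters_imp_inj_on[where act = act and V = V and p = "x i" and q = "x j", OF W(2)])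
      (use ij disj in auto)
  then have "card (s ` W) = card W" by (rule card_image)
  moreover have "independence_set act k U (s ` W)"
    by (rule independence_set_image[where act = act and s = s and V = V and x = x, OF W(2)]) (use VU ij in auto)
  ultimately show "\<exists>J. finite J \<and> n \<le> card J \<and> independence_set act k U J"
    using W by (intro exI[of _ "s ` W"]) auto
qed

section \<open>Covering numbers from below\<close>

text \<open>Injectivity of \<open>s\<close> on \<open>W\<close> turns a labelling of indices into
  one of elements; \<open>\<rho>\<close> selects for each labelled point one of its positions in the
  tuple.\<close>

lemma shatters_of_independence_set:
  assumes ind: "independence_set act k (\<lambda>i. U (x i)) (s ` W)" and "inj_on s W" "finite W"
  shows "shatters (\<lambda>i p. act (s i) -` U p) (x ` {..<k}) UNIV W"
  unfolding shatters_def
proof (intro allI impI)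
  fix \<sigma> assume \<sigma>: "\<forall>i\<in>W. \<sigma> i \<in> x ` {..<k}"
  \<comment> \<open>Independence speaks of nonempty \<open>I\<close> only; for empty
    \<open>W\<close> any point will do.\<close>
  show "\<exists>y\<in>UNIV. \<forall>i\<in>W. y \<in> act (s i) -` U (\<sigma> i)"
  proof (cases "W = {}")
    case False
    from \<sigma> have "\<forall>i\<in>W. \<exists>m<k. \<sigma> i = x m" by auto
    then obtain \<rho> where \<rho>: "\<forall>i\<in>W. \<rho> i < k \<and> \<sigma> i = x (\<rho> i)" by metis
    have "(\<Inter>g\<in>s ` W. act g -` U (x ((\<rho> \<circ> the_inv_into W s) g))) \<noteq> {}"
      by (rule ind[unfolded independence_set_def, rule_format])
        (use False assms \<rho> in \<open>auto simp: the_inv_into_f_f\<close>)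
    then obtain y where "\<forall>i\<in>W. act (s i) y \<in> U (x (\<rho> (the_inv_into W s (s i))))" by auto
    then have "\<forall>i\<in>W. act (s i) y \<in> U (\<sigma> i)" using assms \<rho> by (simp add: the_inv_into_f_f)
    then show ?thesis by auto
  qed simp
qed

text \<open>The functions \<open>V\<close> are arbitrary outside \<open>{1..n}\<close>; restricting
  them keeps the intersection and leaves only finitely many.\<close>

lemma finite_join_seq: "finite \<U> \<Longrightarrow> finite (join_seq act s \<U> n)"
proof -
  assume "finite \<U>"
  have "join_seq act s \<U> n \<subseteq> (\<lambda>V. \<Inter>i\<in>{1..n}. act (s i) -` V i) ` (PiE {1..n} (\<lambda>_. \<U>))"
  proof
    fix B assume "B \<in> join_seq act s \<U> n"
    then obtain V where V: "B = (\<Inter>i\<in>{1..n}. act (s i) -` V i)" "\<forall>i\<in>{1..n}. V i \<in> \<U>"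
      by (auto simp: join_seq_def)
    then have "B = (\<Inter>i\<in>{1..n}. act (s i) -` (restrict V {1..n}) i)" by simp
    moreover have "restrict V {1..n} \<in> PiE {1..n} (\<lambda>_. \<U>)" using V(2) by auto
    ultimately show "B \<in> (\<lambda>V. \<Inter>i\<in>{1..n}. act (s i) -` V i) ` (PiE {1..n} (\<lambda>_. \<U>))" by blast
  qed
  moreover have "finite (PiE {1..n} (\<lambda>_. \<U>))" using \<open>finite \<U>\<close> by (intro finite_PiE) auto
  ultimately show ?thesis by (meson finite_imageI finite_subset)
qed

lemma Union_join_seq:
  assumes "\<Union>\<U> = UNIV"
  shows "\<Union>(join_seq act s \<U> n) = UNIV"
proof -
  have "x \<in> \<Union>(join_seq act s \<U> n)" for x
  proof -
    have "\<forall>i. \<exists>V\<in>\<U>. act (s i) x \<in> V" using assms by blast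
    then obtain V where "\<forall>i. V i \<in> \<U> \<and> act (s i) x \<in> V i" by metis
    then have "x \<in> (\<Inter>i\<in>{1..n}. act (s i) -` V i)"
      "(\<Inter>i\<in>{1..n}. act (s i) -` V i) \<in> join_seq act s \<U> n"
      by (auto simp: join_seq_def)
    then show ?thesis by blast
  qed
  then show ?thesis by blast
qed

text \<open>Double counting: a witness is chosen for each of the \<open>card P ^ card W\<close>
  labellings of \<open>W\<close>. A member of the join excludes one label at each index of
  \<open>W\<close>, so it contains the witnesses of at most \<open>(card P - 1) ^ card W\<close>
  labellings.\<close>

lemma power_le_N_cover_join_seq:
  fixes U :: "'p \<Rightarrow> 'x set"
  assumes P: "finite P" "card P \<ge> 2"
    and disj: "\<And>p q. p \<in> P \<Longrightarrow> q \<in> P \<Longrightarrow> p \<noteq> q \<Longrightarrow> U p \<inter> U q = {}"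
    and sh: "shatters (\<lambda>i p. act (s i) -` U p) P UNIV W" and W: "W \<subseteq> {1..n}"
  shows "card P ^ card W \<le> N_cover (join_seq act s ((\<lambda>p. - U p) ` P) n) * (card P - 1) ^ card W"
proof -
  let ?C = "join_seq act s ((\<lambda>p. - U p) ` P) n"
  have finW: "finite W" using W finite_subset by blast
  \<comment> \<open>The complements of two disjoint sets \<open>U p\<close> and \<open>U q\<close>
    already cover the space.\<close>
  have "\<Union>((\<lambda>p. - U p) ` P) = UNIV"
  proof -
    have "card P > 1" using P(2) by simp
    then obtain p q where "p \<in> P" "q \<in> P" "p \<noteq> q"
      by (metis card_le_Suc0_iff_eq not_less_eq One_nat_def P(1) not_le)
    then show ?thesis using disj[of p q] by blast
  qed
  then have "\<Union>?C = UNIV" by (rule Union_join_seq)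
  moreover have "finite ?C" using P(1) by (intro finite_join_seq) auto
  ultimately obtain F where F: "F \<subseteq> ?C" "finite F" "card F = N_cover ?C" "\<Union>F = UNIV"
    using N_cover_attained by metis
  have "\<forall>\<sigma>\<in>PiE W (\<lambda>_. P). \<exists>y. \<forall>i\<in>W. act (s i) y \<in> U (\<sigma> i)"
    using sh unfolding shatters_def by (auto simp: PiE_iff)
  then obtain y where y: "\<forall>\<sigma>\<in>PiE W (\<lambda>_. P). \<forall>i\<in>W. act (s i) (y \<sigma>) \<in> U (\<sigma> i)" by metis
  let ?T = "\<lambda>B. {\<sigma> \<in> PiE W (\<lambda>_. P). y \<sigma> \<in> B}"
  have card_T: "card (?T B) \<le> (card P - 1) ^ card W" if "B \<in> F" for B
  proof -
    from that F(1) obtain V where V: "B = (\<Inter>i\<in>{1..n}. act (s i) -` V i)"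
      "\<forall>i\<in>{1..n}. V i \<in> (\<lambda>p. - U p) ` P" by (auto simp: join_seq_def)
    then have "\<forall>i\<in>{1..n}. \<exists>p\<in>P. V i = - U p" by blast
    then obtain v where v: "\<forall>i\<in>{1..n}. v i \<in> P \<and> V i = - U (v i)" by metis
    have "?T B \<subseteq> PiE W (\<lambda>i. P - {v i})"
    proof
      fix \<sigma> assume \<sigma>: "\<sigma> \<in> ?T B"
      have "\<sigma> i \<noteq> v i" if "i \<in> W" for i
      proof -
        have i: "i \<in> {1..n}" using that W by blast
        have "act (s i) (y \<sigma>) \<in> V i" using \<sigma> V(1) i by blast
        then have "act (s i) (y \<sigma>) \<notin> U (v i)" using v i by auto
        moreover have "act (s i) (y \<sigma>) \<in> U (\<sigma> i)" using y \<sigma> that by blast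
        ultimately show ?thesis by metis
      qed
      then show "\<sigma> \<in> PiE W (\<lambda>i. P - {v i})" using \<sigma> by (auto simp: PiE_iff)
    qed
    then have "card (?T B) \<le> card (PiE W (\<lambda>i. P - {v i}))"
      using P(1) finW by (intro card_mono finite_PiE) auto
    also have "\<dots> = (\<Prod>i\<in>W. card (P - {v i}))" using finW by (rule card_PiE)
    also have "\<dots> = (\<Prod>i\<in>W. card P - 1)" using v W P(1) by (intro prod.cong) auto
    finally show ?thesis by simp
  qed
  have "PiE W (\<lambda>_. P) = (\<Union>B\<in>F. ?T B)"
  proof -
    have "\<exists>B\<in>F. y \<sigma> \<in> B" for \<sigma> using F(4) by (metis UNIV_I Union_iff)
    then show ?thesis by auto
  qed
  then have "card (PiE W (\<lambda>_. P)) \<le> (\<Sum>B\<in>F. card (?T B))"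
    using card_UN_le[OF F(2), of ?T] by simp
  also have "\<dots> \<le> (\<Sum>B\<in>F. (card P - 1) ^ card W)" using card_T by (rule sum_mono)
  finally show ?thesis using finW F(3) by (simp add: card_PiE)
qed

section \<open>IN-tuples are sequence entropy tuples\<close>

text \<open>The dyadic blocks are pairwise disjoint, so the prescriptions never conflict. The
  indices 0 and 1 lie in no block and get unspecified values.\<close>

lemma exists_sequence_with_blocks:
  fixes e :: "nat \<Rightarrow> nat \<Rightarrow> 'g"
  shows "\<exists>s. \<forall>m. \<forall>i\<in>{2 ^ m<..2 ^ Suc m}. s i = e m i"
proof -
  define s where "s i = e (THE m. i \<in> {2 ^ m<..2 ^ Suc m}) i" for i :: nat
  have "s i = e m i" if "i \<in> {2 ^ m<..2 ^ Suc m}" for i m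
  proof -
    have "m' = m" if "i \<in> {2 ^ m'<..2 ^ Suc m'}" for m'
    proof -
      have "2 ^ m' < (2::nat) ^ Suc m" "2 ^ m < (2::nat) ^ Suc m'"
        using that \<open>i \<in> {2 ^ m<..2 ^ Suc m}\<close> unfolding greaterThanAtMost_iff by linarith+
      then have "m' < Suc m" "m < Suc m'" by (meson one_less_numeral_iff power_less_imp_less_exp semiring_norm(76))+
      then show ?thesis by linarith
    qed
    then have "(THE m. i \<in> {2 ^ m<..2 ^ Suc m}) = m" using that by blast
    then show ?thesis by (simp add: s_def)
  qed
  then show ?thesis by blast
qed

lemma IN_tuple_imp_seq_entropy_tuple:
  fixes act :: "'g \<Rightarrow> 'x::t2_space \<Rightarrow> 'x"
  assumes nd: "\<not> in_diagonal k x" and IN: "IN_tuple act k x"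
  shows "seq_entropy_tuple act k x"
  unfolding seq_entropy_tuple_def
proof (intro conjI nd allI impI, elim conjE)
  fix U :: "'x \<Rightarrow> 'x set"
  let ?P = "x ` {..<k}"
  assume U: "\<forall>p\<in>?P. closed (U p) \<and> p \<in> interior (U p)"
    and disj: "\<forall>p\<in>?P. \<forall>q\<in>?P. p \<noteq> q \<longrightarrow> U p \<inter> U q = {}"
  note two = card_image_ge_two[OF nd]
  \<comment> \<open>The block has \<open>2 ^ m\<close> indices, so it injects into any independence
    set of at least that size, and subsets of independence sets are again independent.\<close>
  have "\<exists>e::nat \<Rightarrow> 'g. inj_on e {2 ^ m<..2 ^ Suc m} \<and>
      independence_set act k (\<lambda>i. U (x i)) (e ` {2 ^ m<..2 ^ Suc m})" for m :: nat
  proof -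
    have "\<exists>J. finite J \<and> card J \<ge> 2 ^ m \<and> independence_set act k (\<lambda>i. U (x i)) J"
      using IN[unfolded IN_tuple_def, rule_format, of "\<lambda>i. U (x i)" "2 ^ m"] U by simp
    then obtain J where J: "finite J" "2 ^ m \<le> card J"
      "independence_set act k (\<lambda>i. U (x i)) J" by blast
    have "\<exists>e::nat \<Rightarrow> 'g. e ` {2 ^ m<..2 ^ Suc m} \<subseteq> J \<and> inj_on e {2 ^ m<..2 ^ Suc m}"
      by (rule card_le_inj) (use J in auto)
    then obtain e :: "nat \<Rightarrow> 'g" where e: "e ` {2 ^ m<..2 ^ Suc m} \<subseteq> J" "inj_on e {2 ^ m<..2 ^ Suc m}" by blast
    then have "independence_set act k (\<lambda>i. U (x i)) (e ` {2 ^ m<..2 ^ Suc m})"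
      using J(3) unfolding independence_set_def by (meson subset_trans)
    then show ?thesis using e by blast
  qed
  then obtain e :: "nat \<Rightarrow> nat \<Rightarrow> 'g" where e: "\<And>m. inj_on (e m) {2 ^ m<..2 ^ Suc m}"
    "\<And>m. independence_set act k (\<lambda>i. U (x i)) (e m ` {2 ^ m<..2 ^ Suc m})" by metis
  obtain s where s: "\<And>m i. i \<in> {2 ^ m<..2 ^ Suc m} \<Longrightarrow> s i = e m i"
    using exists_sequence_with_blocks[of e] by blast
  let ?l = "real (card ?P)"
  let ?f = "\<lambda>n. ln (real (N_cover (join_seq act s ((\<lambda>p. - U p) ` ?P) n))) / real n"
  \<comment> \<open>Half of ln(l / (l - 1)), since the last block holds half of the first
    \<open>2 ^ Suc m\<close> indices.\<close>
  define c where "c = (ln ?l - ln (?l - 1)) / 2"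
  have c: "c > 0" using two by (simp add: c_def)
  have fc: "?f (2 ^ Suc m) \<ge> c" for m
  proof -
    let ?W = "{2 ^ m<..2 ^ Suc m :: nat}"
    let ?N = "N_cover (join_seq act s ((\<lambda>p. - U p) ` ?P) (2 ^ Suc m))"
    have cW: "card ?W = 2 ^ m" by simp
    have "s ` ?W = e m ` ?W" using s by (intro image_cong) auto
    moreover have "inj_on s ?W" using e(1)[of m] s by (subst inj_on_cong[of _ _ "e m"]) auto
    ultimately have "shatters (\<lambda>i p. act (s i) -` U p) ?P UNIV ?W"
      using e(2)[of m] by (intro shatters_of_independence_set) auto
    then have "card ?P ^ card ?W \<le> ?N * (card ?P - 1) ^ card ?W"
      by (intro power_le_N_cover_join_seq) (use two disj in auto)
    then have "real (card ?P ^ 2 ^ m) \<le> real (?N * (card ?P - 1) ^ 2 ^ m)"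
      unfolding cW of_nat_le_iff .
    then have ge: "?l ^ 2 ^ m \<le> real ?N * (?l - 1) ^ 2 ^ m"
      using two by (simp add: of_nat_diff)
    moreover have l0: "?l ^ 2 ^ m > 0" using two by (intro zero_less_power) linarith
    \<comment> \<open>Positivity of the left side of \<open>ge\<close> forces a positive covering
      number, so the logarithm of the product can be split.\<close>
    ultimately have "?N > 0" by (metis gr0I mult_zero_left not_less of_nat_0)
    have "ln (?l ^ 2 ^ m) \<le> ln (real ?N * (?l - 1) ^ 2 ^ m)"
      using ge l0 by (subst ln_le_cancel_iff) linarith+
    also have "\<dots> = ln (real ?N) + ln ((?l - 1) ^ 2 ^ m)"
      using \<open>?N > 0\<close> two by (intro ln_mult_pos) auto
    finally have "2 ^ m * ln ?l \<le> ln (real ?N) + 2 ^ m * ln (?l - 1)"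
      using two by (simp add: ln_realpow)
    then have "2 ^ m * (ln ?l - ln (?l - 1)) \<le> ln (real ?N)" by (simp add: algebra_simps)
    then show ?thesis by (simp add: c_def field_simps)
  qed
  \<comment> \<open>The bound is available along the indices \<open>2 ^ Suc m\<close>, and a limsup
    dominates the limsup along any subsequence.\<close>
  have "ereal c \<le> htop_seq act ((\<lambda>p. - U p) ` ?P) s"
  proof -
    have sm: "strict_mono (\<lambda>m. 2 ^ Suc m :: nat)" by (intro strict_monoI) simp
    have "ereal c \<le> liminf ((\<lambda>n. ereal (?f n)) \<circ> (\<lambda>m. 2 ^ Suc m))"
      by (intro Liminf_bounded always_eventually allI) (use fc in simp)
    also have "\<dots> \<le> limsup ((\<lambda>n. ereal (?f n)) \<circ> (\<lambda>m. 2 ^ Suc m))"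
      by (rule Liminf_le_Limsup) simp
    also have "\<dots> \<le> limsup (\<lambda>n. ereal (?f n))" using sm by (rule limsup_subseq_mono)
    finally show ?thesis by (simp only: htop_seq_def)
  qed
  then have "htop_seq act ((\<lambda>p. - U p) ` ?P) s > 0"
    using c by (metis ereal_less(2) less_le_trans)
  then show "\<exists>s. htop_seq act ((\<lambda>p. - U p) ` ?P) s > 0" by blast
qed

theorem theorem5p9:
  fixes act :: "'g::{topological_space,monoid_mult} \<Rightarrow> 'x::t2_space \<Rightarrow> 'x"
    and k :: nat and x :: "nat \<Rightarrow> 'x"
  assumes "top_monoid_action act"
    and "k \<ge> 2"
    and "\<not> in_diagonal k x"
  shows "seq_entropy_tuple act k x \<longleftrightarrow> IN_tuple act k x"
  using assms seq_entropy_tuple_imp_IN_tuple IN_tuple_imp_seq_entropy_tuple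
  unfolding top_monoid_action_def by blast

end
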